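(* Let $\mathbf{Z}$ be a real $m\times n$ random matrix with independent, zero-mean entries. Then \[ \mathbb{E}\|\mathbf{Z}\|_{\infty\to2}\le 2\,\mathbb{E}\|\mathbf{Z}\|_{\mathrm{F}}+2\inf_{\mathbf{D}}\mathbb{E}\|\mathbf{Z}\mathbf{D}^{-1}\|_{2\to\infty}, \] where the infimum is over all $n\times n$ diagonal matrices $\mathbf{D}$ with strictly positive diagonal entries satisfying $\mathrm{trace}(\mathbf{D}^2)=1$.
   Context: For a real $m\times n$ matrix $\mathbf{A}$: $\|\mathbf{A}\|_{\infty\to2}=\max_{\mathbf{u}\ne\mathbf{0}}\|\mathbf{A}\mathbf{u}\|_2/\|\mathbf{u}\|_\infty$; $\|\mathbf{A}\|_{\mathrm{F}}$ is the Frobenius norm; $\|\mathbf{A}\|_{2\to\infty}=\max_{\mathbf{u}\ne\mathbf{0}}\|\mathbf{A}\mathbf{u}\|_\infty/\|\mathbf{u}\|_2$, which equals the largest $\ell_2$ norm of a row of $\mathbf{A}$. *)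

theory Defs
  imports "HOL-Probability.Probability"
begin

text \<open>
  Operator norms induced by vector norms. On \<open>real ^ 'n\<close> the library's \<open>norm\<close> is the Euclidean
  norm and \<open>infnorm\<close> the maximum norm. The suprema are over nonempty bounded sets: see
  \<open>bdd_above_inf_to_2\<close> and \<open>bdd_above_2_to_inf\<close> below.
\<close>

definition norm_inf_to_2 :: "real ^ 'n ^ 'm \<Rightarrow> real" where
  "norm_inf_to_2 A = (SUP u \<in> {u :: real ^ 'n. u \<noteq> 0}. norm (A *v u) / infnorm u)"

definition norm_2_to_inf :: "real ^ 'n ^ 'm \<Rightarrow> real" where
  "norm_2_to_inf A = (SUP u \<in> {u :: real ^ 'n. u \<noteq> 0}. infnorm (A *v u) / norm u)"

definition frobenius_norm :: "real ^ 'n ^ 'm \<Rightarrow> real" where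
  "frobenius_norm A = sqrt (\<Sum>i\<in>UNIV. \<Sum>j\<in>UNIV. (A $ i $ j)\<^sup>2)"

definition diagonal_matrix :: "real ^ 'n ^ 'n \<Rightarrow> bool" where
  "diagonal_matrix D \<longleftrightarrow> (\<forall>i j. i \<noteq> j \<longrightarrow> D $ i $ j = 0)"

definition scaling_matrices :: "(real ^ 'n ^ 'n) set" where
  "scaling_matrices = {D. diagonal_matrix D \<and> (\<forall>i. D $ i $ i > 0) \<and> trace (D ** D) = 1}"

lemma bdd_above_inf_to_2:
  fixes A :: "real ^ 'n ^ 'm"
  shows "bdd_above ((\<lambda>u. norm (A *v u) / infnorm u) ` {u. u \<noteq> 0})"
proof (rule bdd_aboveI2)
  fix u :: "real ^ 'n" assume "u \<in> {u. u \<noteq> 0}"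
  then have pos: "infnorm u > 0" by (simp add: infnorm_pos_lt)
  have "norm (A *v u) \<le> onorm ((*v) A) * norm u"
    by (rule onorm) (rule matrix_vector_mul_bounded_linear)
  also have "\<dots> \<le> onorm ((*v) A) * (sqrt DIM(real ^ 'n) * infnorm u)"
    by (intro mult_left_mono norm_le_infnorm onorm_pos_le matrix_vector_mul_bounded_linear)
  finally show "norm (A *v u) / infnorm u \<le> onorm ((*v) A) * sqrt DIM(real ^ 'n)"
    using pos by (simp add: divide_le_eq mult.assoc)
qed

lemma bdd_above_2_to_inf:
  fixes A :: "real ^ 'n ^ 'm"
  shows "bdd_above ((\<lambda>u. infnorm (A *v u) / norm u) ` {u. u \<noteq> 0})"
proof (rule bdd_aboveI2)
  fix u :: "real ^ 'n" assume "u \<in> {u. u \<noteq> 0}"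
  then have pos: "norm u > 0" by simp
  have "infnorm (A *v u) \<le> norm (A *v u)" by (rule infnorm_le_norm)
  also have "\<dots> \<le> onorm ((*v) A) * norm u"
    by (rule onorm) (rule matrix_vector_mul_bounded_linear)
  finally show "infnorm (A *v u) / norm u \<le> onorm ((*v) A)"
    using pos by (simp add: divide_le_eq)
qed

text \<open>The infimum of the (nonnegative) expectations below is over a nonempty set.\<close>

lemma scaling_matrices_nonempty: "(scaling_matrices :: (real ^ 'n ^ 'n) set) \<noteq> {}"
proof -
  let ?D = "mat (1 / sqrt (real CARD('n))) :: real ^ 'n ^ 'n"
  have "?D \<in> scaling_matrices"
    by (simp add: scaling_matrices_def diagonal_matrix_def trace_def matrix_matrix_mult_def
        mat_def if_distrib cong: if_cong)
  then show ?thesis by blast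
qed

end

theory Submission
  imports Defs
begin

text \<open>
  By duality \<open>norm (Z *v u) \<le> infnorm u * (\<Sum>k. \<bar>c\<^sub>k \<bullet> y\<bar>)\<close> for a unit vector \<open>y\<close> and the columns
  \<open>c\<^sub>k\<close> of \<open>Z\<close>, so one has to bound the supremum over \<open>y\<close> of the deviations
  \<open>\<Sum>k. \<bar>c\<^sub>k \<bullet> y\<bar> - E \<bar>c\<^sub>k \<bullet> y\<bar>\<close> and of the means \<open>\<Sum>k. E \<bar>c\<^sub>k \<bullet> y\<bar>\<close>.
  The deviations are removed one independent column at a time. Conditionally on the other columns,
  convexity, symmetrization and contraction replace \<open>\<bar>c \<bullet> y\<bar> - E \<bar>c \<bullet> y\<bar>\<close> by the average over the
  two signs of \<open>\<plusminus> 2 (c \<bullet> y)\<close>; as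
  \<open>norm (w + 2 c)\<^sup>2\<close> and \<open>norm (w - 2 c)\<^sup>2\<close> have mean \<open>norm w\<^sup>2 + 4 norm c\<^sup>2\<close>, concavity of the square
  root then yields the Frobenius norm without any Rademacher variables. The same inequality for the
  identity in place of the absolute value gives \<open>E \<bar>c\<^sub>k \<bullet> y\<bar> \<le> 2 E sqrt (\<Sum>i. (Z\<^sub>i\<^sub>k y\<^sub>i)\<^sup>2)\<close>, and
  Cauchy--Schwarz with weights \<open>D\<^sub>k\<^sub>k\<close> bounds the sum of these over \<open>k\<close>.
\<close>

section \<open>Nonexpansive functions and inner products with the unit ball\<close>

lemma borel_measurable_nonexpansive:
  fixes \<phi> :: "real \<Rightarrow> real"
  assumes "\<And>a b. \<bar>\<phi> a - \<phi> b\<bar> \<le> \<bar>a - b\<bar>"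
  shows "\<phi> \<in> borel_measurable borel"
proof (rule borel_measurable_continuous_onI)
  have "1-lipschitz_on UNIV \<phi>"
    using assms by (auto simp: lipschitz_on_def dist_real_def)
  then show "continuous_on UNIV \<phi>" by (rule lipschitz_on_continuous_on)
qed

lemma abs_inner_le_norm:
  fixes c u :: "'a::real_inner"
  assumes "norm u \<le> 1"
  shows "\<bar>c \<bullet> u\<bar> \<le> norm c"
proof -
  have "norm c * norm u \<le> norm c" using assms by (simp add: mult_left_le)
  with Cauchy_Schwarz_ineq2[of c u] show ?thesis by linarith
qed

section \<open>Symmetrization and contraction for a single random column\<close>

text \<open>The function \<open>h\<close> stands for everything contributed by the other columns,
  which are held fixed. The factor 2 arises by writing \<open>h u + (a - b)\<close> as the mean of
  \<open>h u + 2 * a\<close> and \<open>h u - 2 * b\<close>, so that each half keeps a full copy of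
  \<open>h\<close>.\<close>

lemma nn_integral_SUP_contraction:
  fixes N :: "'a::euclidean_space measure" and h :: "'a \<Rightarrow> real" and \<phi> :: "real \<Rightarrow> real"
  assumes "prob_space N" and sets[measurable_cong]: "sets N = sets borel"
    and int: "integrable N (\<lambda>c. c)"
    and T: "countable T" "0 \<in> T" "T \<subseteq> cball 0 1"
    and lip: "\<And>a b. \<bar>\<phi> a - \<phi> b\<bar> \<le> \<bar>a - b\<bar>" and \<phi>0: "\<phi> 0 = 0"
    and h: "bdd_above (h ` T)" "h 0 = 0"
  shows "(\<integral>\<^sup>+c. ennreal (SUP u\<in>T. h u + (\<phi> (c \<bullet> u) - (\<integral>c'. \<phi> (c' \<bullet> u) \<partial>N))) \<partial>N)
    \<le> (\<integral>\<^sup>+c. ennreal (((SUP u\<in>T. h u + 2 * (c \<bullet> u)) + (SUP u\<in>T. h u - 2 * (c \<bullet> u))) / 2) \<partial>N)"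
proof -
  interpret prob_space N by fact
  have [measurable]: "\<phi> \<in> borel_measurable borel"
    using lip by (rule borel_measurable_nonexpansive)
  obtain H where H: "\<And>u. u \<in> T \<Longrightarrow> h u \<le> H"
    using h(1) by (auto simp: bdd_above_def)
  have inner_le: "\<bar>c \<bullet> u\<bar> \<le> norm c" if "u \<in> T" for c u :: 'a
    using T(3) that by (intro abs_inner_le_norm) auto
  have phi_le: "\<bar>\<phi> (c \<bullet> u)\<bar> \<le> norm c" if "u \<in> T" for c u :: 'a
    using lip[of "c \<bullet> u" 0] \<phi>0 inner_le[OF that, of c] by simp
  define A where "A c = (SUP u\<in>T. h u + 2 * \<phi> (c \<bullet> u))" for c
  define B where "B c = (SUP u\<in>T. h u - 2 * \<phi> (c \<bullet> u))" for c
  define A' where "A' c = (SUP u\<in>T. h u + 2 * (c \<bullet> u))" for c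
  define B' where "B' c = (SUP u\<in>T. h u - 2 * (c \<bullet> u))" for c
  have bdd: "bdd_above ((\<lambda>u. h u + g u) ` T)"
    if "\<And>u. u \<in> T \<Longrightarrow> \<bar>g u\<bar> \<le> 2 * norm c" for c :: 'a and g :: "'a \<Rightarrow> real"
    by (rule bdd_aboveI2[where M = "H + 2 * norm c"]) (use H that in \<open>force simp: abs_le_iff intro!: add_mono\<close>)
  have bA: "bdd_above ((\<lambda>u. h u + 2 * \<phi> (c \<bullet> u)) ` T)" for c
    using phi_le by (intro bdd[of _ c]) (auto simp: abs_mult)
  have bB: "bdd_above ((\<lambda>u. h u - 2 * \<phi> (c \<bullet> u)) ` T)" for c
    using bdd[of "\<lambda>u. - 2 * \<phi> (c \<bullet> u)" c] phi_le[of _ c] by (simp add: abs_mult)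
  have bA': "bdd_above ((\<lambda>u. h u + 2 * (c \<bullet> u)) ` T)" for c
    using inner_le by (intro bdd[of _ c]) (auto simp: abs_mult)
  have bB': "bdd_above ((\<lambda>u. h u - 2 * (c \<bullet> u)) ` T)" for c
    using bdd[of "\<lambda>u. - 2 * (c \<bullet> u)" c] inner_le[of _ c] by (simp add: abs_mult)
  have [measurable]: "A \<in> borel_measurable borel" "B \<in> borel_measurable borel"
    unfolding A_def B_def using T(1) bA bB by (auto intro!: borel_measurable_cSUP)
  \<comment> \<open>The point 0 of \<open>T\<close> contributes the value 0 to each supremum; hence
    \<open>ennreal\<close> truncates nothing later on.\<close>
  have nonneg: "0 \<le> A c" "0 \<le> B c" for c
    unfolding A_def B_def using cSUP_upper[OF T(2) bA[of c]] cSUP_upper[OF T(2) bB[of c]] h(2) \<phi>0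
    by auto
  have Tne: "T \<noteq> {}" using T(2) by auto
  have upper: "A c \<le> H + 2 * norm c" "B c \<le> H + 2 * norm c" for c
    unfolding A_def B_def
    by (intro cSUP_least Tne, use H phi_le[of _ c] in \<open>force simp: abs_le_iff\<close>)+
  have int_norm: "integrable N (\<lambda>c. H + 2 * norm c)"
    using int by (intro Bochner_Integration.integrable_add integrable_mult_right integrable_norm) auto
  have iA: "integrable N A" and iB: "integrable N B"
    by (rule Bochner_Integration.integrable_bound[OF int_norm];
        use nonneg upper in \<open>force intro: order_trans[OF _ abs_ge_self]\<close>)+
  have i\<phi>: "integrable N (\<lambda>c. \<phi> (c \<bullet> u))" if "u \<in> T" for u
    using int by (rule Bochner_Integration.integrable_bound) (use phi_le[OF that] in auto)
  txt \<open>Averaging over an independent copy \<open>c'\<close>: the summand is half of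
    \<open>h u + 2 * \<phi> (c \<bullet> u)\<close> plus half of the mean of \<open>h u - 2 * \<phi> (c' \<bullet> u)\<close>.\<close>
  have step1: "(SUP u\<in>T. h u + (\<phi> (c \<bullet> u) - (\<integral>c'. \<phi> (c' \<bullet> u) \<partial>N))) \<le> (A c + expectation B) / 2" for c
  proof (rule cSUP_least[OF Tne])
    fix u assume u: "u \<in> T"
    have "h u - 2 * (\<integral>c'. \<phi> (c' \<bullet> u) \<partial>N) = (\<integral>c'. h u - 2 * \<phi> (c' \<bullet> u) \<partial>N)"
      using i\<phi>[OF u] by (simp add: prob_space)
    also have "\<dots> \<le> expectation B"
      using i\<phi>[OF u] iB cSUP_upper[OF u bB] unfolding B_def
      by (intro integral_mono) auto
    finally have "h u - 2 * (\<integral>c'. \<phi> (c' \<bullet> u) \<partial>N) \<le> expectation B" .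
    moreover have "h u + 2 * \<phi> (c \<bullet> u) \<le> A c"
      unfolding A_def by (rule cSUP_upper[OF u bA])
    ultimately show "h u + (\<phi> (c \<bullet> u) - (\<integral>c'. \<phi> (c' \<bullet> u) \<partial>N)) \<le> (A c + expectation B) / 2"
      by simp
  qed
  txt \<open>Two-point contraction: \<open>\<phi> a - \<phi> b\<close> is at most \<open>a - b\<close> or \<open>b - a\<close>.\<close>
  have step2: "A c + B c \<le> A' c + B' c" for c
  proof -
    have *: "(h u + 2 * \<phi> (c \<bullet> u)) + (h v - 2 * \<phi> (c \<bullet> v)) \<le> A' c + B' c" if "u \<in> T" "v \<in> T" for u v
    proof -
      have "h u + 2 * (c \<bullet> u) \<le> A' c" "h v + 2 * (c \<bullet> v) \<le> A' c"
        "h u - 2 * (c \<bullet> u) \<le> B' c" "h v - 2 * (c \<bullet> v) \<le> B' c"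
        unfolding A'_def B'_def using that bA' bB' by (auto intro!: cSUP_upper)
      with lip[of "c \<bullet> u" "c \<bullet> v"] show ?thesis by (auto simp: abs_if split: if_splits)
    qed
    have "A c \<le> A' c + B' c - (h v - 2 * \<phi> (c \<bullet> v))" if "v \<in> T" for v
      unfolding A_def using *[OF _ that] by (intro cSUP_least Tne) (simp add: algebra_simps)
    then have "B c \<le> A' c + B' c - A c"
      unfolding B_def by (intro cSUP_least Tne) (simp add: algebra_simps)
    then show ?thesis by simp
  qed
  have eB: "0 \<le> expectation B" using nonneg by simp
  have "(\<integral>\<^sup>+c. ennreal (SUP u\<in>T. h u + (\<phi> (c \<bullet> u) - (\<integral>c'. \<phi> (c' \<bullet> u) \<partial>N))) \<partial>N)
      \<le> (\<integral>\<^sup>+c. ennreal ((A c + expectation B) / 2) \<partial>N)"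
    by (intro nn_integral_mono ennreal_leI step1)
  also have "\<dots> = ennreal (\<integral>c. (A c + expectation B) / 2 \<partial>N)"
    using iA nonneg eB by (intro nn_integral_eq_integral) auto
  \<comment> \<open>The independent copy is removed again: only the mean of \<open>B\<close> enters,
    and it is the same whether \<open>B\<close> is evaluated at the copy or at \<open>c\<close>
    itself.\<close>
  also have "(\<integral>c. (A c + expectation B) / 2 \<partial>N) = (\<integral>c. (A c + B c) / 2 \<partial>N)"
    using iA iB by (simp add: prob_space)
  also have "ennreal \<dots> = (\<integral>\<^sup>+c. ennreal ((A c + B c) / 2) \<partial>N)"
    using iA iB nonneg by (intro nn_integral_eq_integral[symmetric]) auto
  also have "\<dots> \<le> (\<integral>\<^sup>+c. ennreal ((A' c + B' c) / 2) \<partial>N)"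
    by (intro nn_integral_mono ennreal_leI divide_right_mono step2) auto
  finally show ?thesis unfolding A'_def B'_def .
qed

section \<open>Iteration over independent columns\<close>

text \<open>The parallelogram identity evaluates the mean of the two radicands, and the mean of two
  square roots is at most the root of the mean. In the induction below \<open>s\<close> holds the
  contribution of the remaining columns.\<close>

lemma sqrt_parallelogram_le:
  fixes w c :: "'a::real_inner"
  assumes "0 \<le> s"
  shows "(sqrt ((norm (w + 2 *\<^sub>R c))\<^sup>2 + s) + sqrt ((norm (w - 2 *\<^sub>R c))\<^sup>2 + s)) / 2
    \<le> sqrt ((norm w)\<^sup>2 + (4 * (norm c)\<^sup>2 + s))"
proof -
  let ?a = "sqrt ((norm (w + 2 *\<^sub>R c))\<^sup>2 + s)" and ?b = "sqrt ((norm (w - 2 *\<^sub>R c))\<^sup>2 + s)"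
  have "((?a + ?b) / 2)\<^sup>2 \<le> (?a\<^sup>2 + ?b\<^sup>2) / 2"
    using zero_le_power2[of "?a - ?b"] by (simp add: power2_eq_square field_simps del: real_sqrt_mult_self)
  also have "\<dots> = ((norm (w + 2 *\<^sub>R c))\<^sup>2 + (norm (w - 2 *\<^sub>R c))\<^sup>2) / 2 + s"
    using assms by simp
  also have "\<dots> = (norm w)\<^sup>2 + (4 * (norm c)\<^sup>2 + s)"
    using assms by (simp add: power2_norm_eq_inner algebra_simps inner_commute)
  finally show ?thesis by (rule real_le_rsqrt)
qed

text \<open>The set \<open>T\<close> is kept countable so that the suprema below are measurable.\<close>

lemma nn_integral_PiM_SUP_le:
  fixes N :: "'k \<Rightarrow> 'a::euclidean_space measure" and \<phi> :: "real \<Rightarrow> real"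
  assumes prob: "\<And>k. prob_space (N k)" and sets: "\<And>k. sets (N k) = sets borel"
    and int: "\<And>k. integrable (N k) (\<lambda>c. c)"
    and T: "countable T" "0 \<in> T" "T \<subseteq> cball 0 1"
    and lip: "\<And>a b. \<bar>\<phi> a - \<phi> b\<bar> \<le> \<bar>a - b\<bar>" and \<phi>0: "\<phi> 0 = 0"
    and K: "finite K"
  shows "(\<integral>\<^sup>+x. ennreal (SUP u\<in>T. w \<bullet> u + (\<Sum>k\<in>K. \<phi> (x k \<bullet> u) - (\<integral>c. \<phi> (c \<bullet> u) \<partial>N k))) \<partial>PiM K N)
    \<le> (\<integral>\<^sup>+x. ennreal (sqrt ((norm w)\<^sup>2 + 4 * (\<Sum>k\<in>K. (norm (x k))\<^sup>2))) \<partial>PiM K N)"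
proof -
  interpret product_prob_space N by (intro product_prob_spaceI prob)
  note [measurable_cong] = sets
  have [measurable]: "\<phi> \<in> borel_measurable borel"
    using lip by (rule borel_measurable_nonexpansive)
  have inner_le: "\<bar>c \<bullet> u\<bar> \<le> norm c" if "u \<in> T" for c u :: 'a
    using T(3) that by (intro abs_inner_le_norm) auto
  have phi_le: "\<bar>\<phi> (c \<bullet> u)\<bar> \<le> norm c" if "u \<in> T" for c u :: 'a
    using lip[of "c \<bullet> u" 0] \<phi>0 inner_le[OF that, of c] by simp
  define \<mu> where "\<mu> k u = (\<integral>c. \<phi> (c \<bullet> u) \<partial>N k)" for k u
  define m where "m k = (\<integral>c. norm c \<partial>N k)" for k
  \<comment> \<open>The bound is uniform in \<open>u\<close>, which keeps the supremum over
    \<open>T\<close> finite after centring.\<close>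
  have mu_le: "\<bar>\<mu> k u\<bar> \<le> m k" if "u \<in> T" for k u
  proof -
    have "\<bar>\<mu> k u\<bar> \<le> (\<integral>c. \<bar>\<phi> (c \<bullet> u)\<bar> \<partial>N k)"
      unfolding \<mu>_def by (rule integral_abs_bound)
    also have "\<dots> \<le> m k"
      unfolding m_def using int phi_le[OF that] by (intro integral_mono') auto
    finally show ?thesis .
  qed
  have bdd: "bdd_above ((\<lambda>u. w \<bullet> u + (\<Sum>k\<in>K. \<phi> (x k \<bullet> u) - \<mu> k u)) ` T)" for K and w :: 'a and x
  proof (rule bdd_aboveI2)
    fix u assume u: "u \<in> T"
    show "w \<bullet> u + (\<Sum>k\<in>K. \<phi> (x k \<bullet> u) - \<mu> k u) \<le> norm w + (\<Sum>k\<in>K. norm (x k) + m k)"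
    proof (intro add_mono sum_mono)
      show "w \<bullet> u \<le> norm w" using inner_le[OF u, of w] by linarith
      show "\<phi> (x k \<bullet> u) - \<mu> k u \<le> norm (x k) + m k" for k
        using phi_le[OF u, of "x k"] mu_le[OF u, of k] by linarith
    qed
  qed
  \<comment> \<open>The vector \<open>w\<close> collects the shifts by plus or minus twice a column
    that are left behind by the columns already replaced. With this linear term the claim reproduces
    itself under induction on \<open>K\<close>, provided that \<open>w\<close> stays
    arbitrary.\<close>
  define F where "F K w x = (SUP u\<in>T. w \<bullet> u + (\<Sum>k\<in>K. \<phi> (x k \<bullet> u) - \<mu> k u))"
    for K :: "'k set" and w x
  define S where "S K w x = sqrt ((norm w)\<^sup>2 + 4 * (\<Sum>k\<in>K. (norm (x k))\<^sup>2))"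
    for K :: "'k set" and w :: 'a and x :: "'k \<Rightarrow> 'a"
  have F_meas[measurable]: "(\<lambda>z. F K (f z) (g z)) \<in> borel_measurable M"
    if [measurable]: "f \<in> borel_measurable M" "\<And>k. k \<in> K \<Longrightarrow> (\<lambda>z. g z k) \<in> borel_measurable M"
    for f :: "'z \<Rightarrow> 'a" and g M K
    unfolding F_def using T(1) bdd by (intro borel_measurable_cSUP) auto
  have F_nonneg: "0 \<le> F K w x" for K w x
    unfolding F_def using cSUP_upper[OF T(2) bdd[of w x K]] \<phi>0 by (simp add: \<mu>_def)
  have "(\<integral>\<^sup>+x. ennreal (F K w x) \<partial>PiM K N) \<le> (\<integral>\<^sup>+x. ennreal (S K w x) \<partial>PiM K N)"
    using K
  proof (induction K arbitrary: w)
    case empty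
    have "F {} w x \<le> S {} w x" for x
      unfolding F_def S_def using T(2) inner_le[of _ w]
      by (auto intro!: cSUP_least simp: abs_le_iff)
    then show ?case by (intro nn_integral_mono ennreal_leI)
  next
    case (insert k K)
    have upd: "F (insert k K) w (x(k := c))
        = (SUP u\<in>T. (w \<bullet> u + (\<Sum>k\<in>K. \<phi> (x k \<bullet> u) - \<mu> k u)) + (\<phi> (c \<bullet> u) - \<mu> k u))" for w x c
      unfolding F_def using insert(1,2)
      by (intro SUP_cong refl) (auto simp: add_ac intro!: sum.cong)
    have ignore: "F K w (x(k := c)) = F K w x" for w x c
      unfolding F_def using insert(2) by (intro SUP_cong refl arg_cong2[where f="(+)"] sum.cong) auto
    let ?G = "\<lambda>x c. (F K (w + 2 *\<^sub>R c) x + F K (w - 2 *\<^sub>R c) x) / 2"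
    have step: "(\<integral>\<^sup>+c. ennreal (F (insert k K) w (x(k := c))) \<partial>N k) \<le> (\<integral>\<^sup>+c. ennreal (?G x c) \<partial>N k)" for x
      using nn_integral_SUP_contraction[OF prob sets int T lip \<phi>0 bdd[of w x K], of k] \<phi>0
      unfolding upd by (simp add: F_def \<mu>_def inner_add_left inner_diff_left algebra_simps)
    have "(\<integral>\<^sup>+x. ennreal (F (insert k K) w x) \<partial>PiM (insert k K) N)
        = (\<integral>\<^sup>+x. (\<integral>\<^sup>+c. ennreal (F (insert k K) w (x(k := c))) \<partial>N k) \<partial>PiM K N)"
      using insert(1,2) by (intro product_nn_integral_insert) auto
    also have "\<dots> \<le> (\<integral>\<^sup>+x. (\<integral>\<^sup>+c. ennreal (?G x c) \<partial>N k) \<partial>PiM K N)"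
      by (intro nn_integral_mono step)
    \<comment> \<open>By \<open>ignore\<close> the update at \<open>k\<close> changes no value, but
      it makes the integrand a function of one point of the product over \<open>insert k K\<close>.
      Evaluating that product integral in both orders then exchanges the two integrations.\<close>
    also have "\<dots> = (\<integral>\<^sup>+x. (\<integral>\<^sup>+c. ennreal (?G (x(k := c)) c) \<partial>N k) \<partial>PiM K N)"
      by (simp add: ignore)
    also have "\<dots> = (\<integral>\<^sup>+c. (\<integral>\<^sup>+x. ennreal (?G (x(k := c)) c) \<partial>PiM K N) \<partial>N k)"
    proof -
      have meas: "(\<lambda>x. ennreal (?G x (x k))) \<in> borel_measurable (PiM (insert k K) N)"
        by (intro measurable_compose[OF _ measurable_ennreal] borel_measurable_divide
            borel_measurable_add F_meas) auto
      show ?thesis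
        using product_nn_integral_insert[OF insert(1,2) meas] product_nn_integral_insert_rev[OF insert(1,2) meas]
        by simp
    qed
    also have "\<dots> = (\<integral>\<^sup>+c. (\<integral>\<^sup>+x. ennreal (?G x c) \<partial>PiM K N) \<partial>N k)"
      by (simp add: ignore)
    also have "\<dots> \<le> (\<integral>\<^sup>+c. (\<integral>\<^sup>+x. ennreal (S (insert k K) w (x(k := c))) \<partial>PiM K N) \<partial>N k)"
    proof (rule nn_integral_mono)
      fix c
      have half: "ennreal ((a + b) / 2) = ennreal a / 2 + ennreal b / 2" if "0 \<le> a" "0 \<le> b" for a b
        using that by (simp add: add_divide_distrib divide_ennreal[symmetric])
      have S_nonneg: "0 \<le> S K w x" for w x
        by (simp add: S_def sum_nonneg)
      have S_meas: "S K w \<in> borel_measurable (PiM K N)" for w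
        unfolding S_def by measurable
      have "(\<integral>\<^sup>+x. ennreal (?G x c) \<partial>PiM K N)
          = (\<integral>\<^sup>+x. ennreal (F K (w + 2 *\<^sub>R c) x) \<partial>PiM K N) / 2
            + (\<integral>\<^sup>+x. ennreal (F K (w - 2 *\<^sub>R c) x) \<partial>PiM K N) / 2"
        by (simp add: half F_nonneg nn_integral_add nn_integral_divide)
      \<comment> \<open>For fixed \<open>c\<close> the induction hypothesis is used twice, at
        \<open>w\<close> shifted by \<open>2c\<close> and by \<open>-2c\<close>.\<close>
      also have "\<dots> \<le> (\<integral>\<^sup>+x. ennreal (S K (w + 2 *\<^sub>R c) x) \<partial>PiM K N) / 2
            + (\<integral>\<^sup>+x. ennreal (S K (w - 2 *\<^sub>R c) x) \<partial>PiM K N) / 2"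
        by (intro add_mono divide_right_mono_ennreal insert.IH)
      also have "\<dots> = (\<integral>\<^sup>+x. ennreal ((S K (w + 2 *\<^sub>R c) x + S K (w - 2 *\<^sub>R c) x) / 2) \<partial>PiM K N)"
        using S_meas by (simp add: half S_nonneg nn_integral_add nn_integral_divide)
      also have "\<dots> \<le> (\<integral>\<^sup>+x. ennreal (S (insert k K) w (x(k := c))) \<partial>PiM K N)"
      proof (intro nn_integral_mono ennreal_leI)
        fix x
        have "(\<Sum>i\<in>K. (norm ((x(k := c)) i))\<^sup>2) = (\<Sum>i\<in>K. (norm (x i))\<^sup>2)"
          using insert(2) by (intro sum.cong) auto
        then have "S (insert k K) w (x(k := c)) = sqrt ((norm w)\<^sup>2 + (4 * (norm c)\<^sup>2 + 4 * (\<Sum>i\<in>K. (norm (x i))\<^sup>2)))"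
          using insert(1,2) by (simp add: S_def distrib_left)
        then show "(S K (w + 2 *\<^sub>R c) x + S K (w - 2 *\<^sub>R c) x) / 2 \<le> S (insert k K) w (x(k := c))"
          using sqrt_parallelogram_le[of "4 * (\<Sum>i\<in>K. (norm (x i))\<^sup>2)" w c]
          by (simp add: S_def sum_nonneg)
      qed
      finally show "(\<integral>\<^sup>+x. ennreal (?G x c) \<partial>PiM K N)
        \<le> (\<integral>\<^sup>+x. ennreal (S (insert k K) w (x(k := c))) \<partial>PiM K N)" .
    qed
    also have "\<dots> = (\<integral>\<^sup>+x. ennreal (S (insert k K) w x) \<partial>PiM (insert k K) N)"
      using insert(1,2) unfolding S_def
      by (intro product_nn_integral_insert_rev[symmetric]) measurable
    finally show ?case .
  qed
  then show ?thesis unfolding F_def S_def \<mu>_def .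
qed

section \<open>From product measures to independent random vectors\<close>

text \<open>The joint law of independent vectors is the product of their laws, so the product bound
  applies with \<open>w = 0\<close>, and the 4 under the root becomes the factor 2. The result
  serves twice: with the absolute value for the columns of the matrix, and with the identity for
  scalar summands.\<close>

lemma (in prob_space) expectation_SUP_le:
  fixes X :: "'k::finite \<Rightarrow> 'a \<Rightarrow> 'b::euclidean_space" and \<phi> :: "real \<Rightarrow> real"
  assumes indep: "indep_vars (\<lambda>_. borel) X UNIV"
    and int: "\<And>k. integrable M (X k)"
    and T: "countable T" "0 \<in> T" "T \<subseteq> cball 0 1"
    and lip: "\<And>a b. \<bar>\<phi> a - \<phi> b\<bar> \<le> \<bar>a - b\<bar>" and \<phi>0: "\<phi> 0 = 0"
  defines "F \<equiv> \<lambda>\<omega>. SUP u\<in>T. \<Sum>k\<in>UNIV. \<phi> (X k \<omega> \<bullet> u) - expectation (\<lambda>\<omega>. \<phi> (X k \<omega> \<bullet> u))"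
  shows "integrable M F"
    and "\<And>\<omega>. 0 \<le> F \<omega>"
    and "\<And>\<omega> u. u \<in> T \<Longrightarrow> (\<Sum>k\<in>UNIV. \<phi> (X k \<omega> \<bullet> u) - expectation (\<lambda>\<omega>. \<phi> (X k \<omega> \<bullet> u))) \<le> F \<omega>"
    and "expectation F \<le> 2 * expectation (\<lambda>\<omega>. sqrt (\<Sum>k\<in>UNIV. (norm (X k \<omega>))\<^sup>2))"
proof -
  have [measurable]: "random_variable borel (X k)" for k using int by auto
  have [measurable]: "\<phi> \<in> borel_measurable borel"
    using lip by (rule borel_measurable_nonexpansive)
  define \<mu> where "\<mu> k u = expectation (\<lambda>\<omega>. \<phi> (X k \<omega> \<bullet> u))" for k u
  have phi_le: "\<bar>\<phi> (c \<bullet> u)\<bar> \<le> norm c" if "u \<in> T" for c u :: 'b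
    using abs_inner_le_norm[of u c] lip[of "c \<bullet> u" 0] \<phi>0 T(3) that by auto
  have mu_le: "\<bar>\<mu> k u\<bar> \<le> expectation (\<lambda>\<omega>. norm (X k \<omega>))" if "u \<in> T" for k u
  proof -
    have "\<bar>\<mu> k u\<bar> \<le> expectation (\<lambda>\<omega>. \<bar>\<phi> (X k \<omega> \<bullet> u)\<bar>)"
      unfolding \<mu>_def by (rule integral_abs_bound)
    also have "\<dots> \<le> expectation (\<lambda>\<omega>. norm (X k \<omega>))"
      using int phi_le[OF that] by (intro integral_mono') auto
    finally show ?thesis .
  qed
  let ?B = "\<lambda>\<omega>. \<Sum>k\<in>UNIV. norm (X k \<omega>) + expectation (\<lambda>\<omega>. norm (X k \<omega>))"
  \<comment> \<open>The right-hand side is free of \<open>u\<close>: it shows that the suprema are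
    finite and, at \<open>x k = X k \<omega>\<close>, gives the integrable majorant
    \<open>?B\<close> of \<open>F\<close>.\<close>
  have le_B: "(\<Sum>k\<in>UNIV. \<phi> (x k \<bullet> u) - \<mu> k u) \<le> (\<Sum>k\<in>UNIV. norm (x k) + expectation (\<lambda>\<omega>. norm (X k \<omega>)))"
    if "u \<in> T" for u x
  proof (rule sum_mono)
    show "\<phi> (x k \<bullet> u) - \<mu> k u \<le> norm (x k) + expectation (\<lambda>\<omega>. norm (X k \<omega>))" for k
      using phi_le[OF that, of "x k"] mu_le[OF that, of k] by linarith
  qed
  have bdd: "bdd_above ((\<lambda>u. \<Sum>k\<in>UNIV. \<phi> (x k \<bullet> u) - \<mu> k u) ` T)" for x
    by (rule bdd_aboveI2) (rule le_B)
  have F_eq: "F = (\<lambda>\<omega>. SUP u\<in>T. \<Sum>k\<in>UNIV. \<phi> (X k \<omega> \<bullet> u) - \<mu> k u)"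
    by (simp add: F_def \<mu>_def)
  show upper: "(\<Sum>k\<in>UNIV. \<phi> (X k \<omega> \<bullet> u) - expectation (\<lambda>\<omega>. \<phi> (X k \<omega> \<bullet> u))) \<le> F \<omega>" if "u \<in> T" for \<omega> u
    using cSUP_upper[OF that bdd] by (simp add: F_eq \<mu>_def)
  show nonneg: "0 \<le> F \<omega>" for \<omega>
    using upper[OF T(2), of \<omega>] \<phi>0 by simp
  have F_le: "F \<omega> \<le> ?B \<omega>" for \<omega>
    unfolding F_eq using T(2) le_B by (intro cSUP_least) auto
  have F_meas[measurable]: "F \<in> borel_measurable M"
    unfolding F_eq using T(1) bdd by (intro borel_measurable_cSUP) auto
  show iF: "integrable M F"
  proof (rule Bochner_Integration.integrable_bound)
    show "integrable M ?B" using int by auto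
    show "AE \<omega> in M. norm (F \<omega>) \<le> norm (?B \<omega>)"
      using nonneg F_le by (auto intro!: AE_I2 order_trans[OF F_le abs_ge_self])
  qed auto
  let ?S = "\<lambda>\<omega>. sqrt (\<Sum>k\<in>UNIV. (norm (X k \<omega>))\<^sup>2)"
  have iS: "integrable M ?S"
  proof (rule Bochner_Integration.integrable_bound)
    show "integrable M (\<lambda>\<omega>. \<Sum>k\<in>UNIV. norm (X k \<omega>))" using int by auto
    show "AE \<omega> in M. norm (?S \<omega>) \<le> norm (\<Sum>k\<in>UNIV. norm (X k \<omega>))"
      using L2_set_le_sum[of UNIV "\<lambda>k. norm (X k _)"]
      by (auto simp: L2_set_def sum_nonneg)
  qed auto
  define N where "N = (\<lambda>k. distr M borel (X k))"
  have D: "PiM UNIV N = distr M (PiM UNIV (\<lambda>_. borel)) (\<lambda>\<omega> k. X k \<omega>)"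
    using indep indep_vars_iff_distr_eq_PiM[where I = UNIV and M' = "\<lambda>_. borel" and X = X]
    by (simp add: N_def restrict_UNIV)
  have \<mu>_N: "(\<integral>c. \<phi> (c \<bullet> u) \<partial>N k) = \<mu> k u" for k u
    unfolding N_def \<mu>_def by (subst integral_distr) auto
  have [measurable]: "(\<lambda>x. SUP u\<in>T. \<Sum>k\<in>UNIV. \<phi> (x k \<bullet> u) - \<mu> k u) \<in> borel_measurable (PiM UNIV (\<lambda>_. borel))"
    using T(1) bdd by (intro borel_measurable_cSUP) auto
  have [measurable]: "(\<lambda>\<omega> k. X k \<omega>) \<in> measurable M (PiM UNIV (\<lambda>_. borel))"
    by (rule measurable_PiM_single') auto
  have "ennreal (expectation F) = (\<integral>\<^sup>+\<omega>. ennreal (F \<omega>) \<partial>M)"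
    using iF nonneg by (intro nn_integral_eq_integral[symmetric]) auto
  also have "\<dots> = (\<integral>\<^sup>+x. ennreal (SUP u\<in>T. \<Sum>k\<in>UNIV. \<phi> (x k \<bullet> u) - \<mu> k u) \<partial>PiM UNIV N)"
    unfolding D F_eq by (subst nn_integral_distr) auto
  also have "\<dots> \<le> (\<integral>\<^sup>+x. ennreal (sqrt (4 * (\<Sum>k\<in>UNIV. (norm (x k))\<^sup>2))) \<partial>PiM UNIV N)"
  proof -
    have "prob_space (N k)" "sets (N k) = sets borel" "integrable (N k) (\<lambda>c. c)" for k
      using int by (auto simp: N_def prob_space_distr integrable_distr_eq)
    from nn_integral_PiM_SUP_le[of N T \<phi> UNIV 0, OF this T lip \<phi>0] show ?thesis
      by (simp add: \<mu>_N)
  qed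
  also have "\<dots> = (\<integral>\<^sup>+\<omega>. ennreal (2 * ?S \<omega>) \<partial>M)"
    unfolding D by (subst nn_integral_distr) (auto simp: real_sqrt_mult)
  also have "\<dots> = ennreal (2 * expectation ?S)"
    using iS by (subst nn_integral_eq_integral) (auto simp: sum_nonneg)
  finally show "expectation F \<le> 2 * expectation ?S"
    by (subst (asm) ennreal_le_iff) (auto simp: sum_nonneg intro!: integral_nonneg_AE)
qed

section \<open>The matrix norms and the scaling matrices\<close>

text \<open>Cauchy--Schwarz on each row gives one inequality; using a row as its own test vector
  gives the other. The finite maximum also makes the norm visibly measurable in the rows.\<close>

lemma norm_2_to_inf_eq_Max:
  fixes A :: "real ^ 'n ^ 'm"
  shows "norm_2_to_inf A = Max (range (\<lambda>i. norm (A $ i)))"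
proof (rule antisym)
  have ne: "{u :: real ^ 'n. u \<noteq> 0} \<noteq> {}"
  proof -
    have "axis undefined 1 \<in> {u :: real ^ 'n. u \<noteq> 0}" by (simp add: axis_eq_0_iff)
    then show ?thesis by blast
  qed
  show "norm_2_to_inf A \<le> Max (range (\<lambda>i. norm (A $ i)))"
    unfolding norm_2_to_inf_def
  proof (rule cSUP_least[OF ne])
    fix u :: "real ^ 'n" assume "u \<in> {u. u \<noteq> 0}"
    then have u: "norm u > 0" by simp
    have "\<bar>(A *v u) $ i\<bar> \<le> Max (range (\<lambda>i. norm (A $ i))) * norm u" for i
    proof -
      have "\<bar>(A *v u) $ i\<bar> \<le> norm (A $ i) * norm u"
        using Cauchy_Schwarz_ineq2[of "A $ i" u] by (simp add: matrix_vector_mul_component)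
      also have "\<dots> \<le> Max (range (\<lambda>i. norm (A $ i))) * norm u"
        by (intro mult_right_mono Max_ge) auto
      finally show ?thesis .
    qed
    then have "infnorm (A *v u) \<le> Max (range (\<lambda>i. norm (A $ i))) * norm u"
      unfolding infnorm_cart by (intro cSup_least) auto
    then show "infnorm (A *v u) / norm u \<le> Max (range (\<lambda>i. norm (A $ i)))"
      using u by (simp add: divide_le_eq)
  qed
  show "Max (range (\<lambda>i. norm (A $ i))) \<le> norm_2_to_inf A"
  proof (rule Max.boundedI; clarsimp)
    fix i
    show "norm (A $ i) \<le> norm_2_to_inf A"
    proof (cases "A $ i = 0")
      case True
      \<comment> \<open>A zero row cannot be its own test vector; any nonzero vector does, since the
        quotient is nonnegative.\<close>
      have "0 \<le> infnorm (A *v axis undefined 1) / norm (axis undefined 1 :: real ^ 'n)"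
        by (simp add: infnorm_pos_le)
      also have "\<dots> \<le> norm_2_to_inf A"
        unfolding norm_2_to_inf_def by (rule cSUP_upper[OF _ bdd_above_2_to_inf]) (simp add: axis_eq_0_iff)
      finally show ?thesis using True by simp
    next
      case False
      have "norm (A $ i) = \<bar>(A *v (A $ i)) $ i\<bar> / norm (A $ i)"
        using False by (simp add: matrix_vector_mul_component dot_square_norm power2_eq_square)
      also have "\<dots> \<le> infnorm (A *v (A $ i)) / norm (A $ i)"
        by (intro divide_right_mono component_le_infnorm_cart) auto
      also have "\<dots> \<le> norm_2_to_inf A"
        unfolding norm_2_to_inf_def by (rule cSUP_upper[OF _ bdd_above_2_to_inf]) (simp add: False)
      finally show ?thesis .
    qed
  qed
qed

lemma norm_row_le_norm_2_to_inf:
  fixes A :: "real ^ 'n ^ 'm"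
  shows "norm (A $ i) \<le> norm_2_to_inf A"
  unfolding norm_2_to_inf_eq_Max by (rule Max_ge) auto

lemma norm_2_to_inf_nonneg: "0 \<le> norm_2_to_inf A"
  using norm_row_le_norm_2_to_inf[of A undefined] norm_ge_zero order_trans by blast

lemma norm_inf_to_2_leI:
  fixes A :: "real ^ 'n ^ 'm"
  assumes "\<And>u. norm (A *v u) \<le> b * infnorm u"
  shows "norm_inf_to_2 A \<le> b"
  unfolding norm_inf_to_2_def
proof (rule cSUP_least)
  have "axis undefined 1 \<in> {u :: real ^ 'n. u \<noteq> 0}" by (simp add: axis_eq_0_iff)
  then show "{u :: real ^ 'n. u \<noteq> 0} \<noteq> {}" by blast
  fix u :: "real ^ 'n" assume "u \<in> {u. u \<noteq> 0}"
  then show "norm (A *v u) / infnorm u \<le> b"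
    using assms[of u] by (simp add: divide_le_eq infnorm_pos_lt)
qed

text \<open>This is the form in which \<open>expectation_SUP_le\<close> delivers its bound when
  applied to the columns.\<close>

lemma frobenius_norm_eq_columns:
  fixes A :: "real ^ 'n ^ 'm"
  shows "frobenius_norm A = sqrt (\<Sum>k\<in>UNIV. (norm (column k A))\<^sup>2)"
proof -
  have "(norm (column k A))\<^sup>2 = (\<Sum>i\<in>UNIV. (A $ i $ k)\<^sup>2)" for k
    unfolding power2_norm_eq_inner by (simp add: inner_vec_def column_def power2_eq_square)
  then show ?thesis
    unfolding frobenius_norm_def by (subst sum.swap) simp
qed

text \<open>The trace condition makes the diagonal of \<open>D\<close> a vector of Euclidean norm 1,
  ready to serve as weights in Cauchy--Schwarz, and the inverse divides column \<open>k\<close> by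
  its weight.\<close>

lemma
  fixes D :: "real ^ 'n ^ 'n"
  assumes "D \<in> scaling_matrices"
  shows scaling_matrix_pos: "0 < D $ k $ k"
    and scaling_matrix_sum_sq: "(\<Sum>k\<in>UNIV. (D $ k $ k)\<^sup>2) = 1"
    and mult_matrix_inv_scaling_nth: "((A :: real ^ 'n ^ 'm) ** matrix_inv D) $ i $ k = A $ i $ k / D $ k $ k"
proof -
  have pos: "0 < D $ k $ k" for k
    using assms by (auto simp: scaling_matrices_def)
  have diag: "D $ i $ j = 0" if "i \<noteq> j" for i j
    using assms that by (auto simp: scaling_matrices_def diagonal_matrix_def)
  have tr: "trace (D ** D) = 1"
    using assms by (auto simp: scaling_matrices_def)
  show "0 < D $ k $ k" by (rule pos)
  have nz: "D $ k $ k \<noteq> 0" for k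
    using pos[of k] by simp
  have "(\<Sum>j\<in>UNIV. D $ k $ j * D $ j $ k) = (\<Sum>j\<in>UNIV. if j = k then (D $ k $ k)\<^sup>2 else 0)" for k
    by (intro sum.cong refl) (use diag in \<open>auto simp: power2_eq_square\<close>)
  then have "(D ** D) $ k $ k = (D $ k $ k)\<^sup>2" for k
    by (simp add: matrix_matrix_mult_def)
  then show "(\<Sum>k\<in>UNIV. (D $ k $ k)\<^sup>2) = 1"
    using tr by (simp add: trace_def)
  define E :: "real ^ 'n ^ 'n" where "E = (\<chi> i j. if i = j then 1 / D $ i $ i else 0)"
  have "(\<Sum>j\<in>UNIV. D $ i $ j * E $ j $ k) = (\<Sum>j\<in>UNIV. if j = k then (if i = k then 1 else 0) else 0)"
    and "(\<Sum>j\<in>UNIV. E $ i $ j * D $ j $ k) = (\<Sum>j\<in>UNIV. if j = i then (if i = k then 1 else 0) else 0)" for i k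
    by (intro sum.cong refl; use diag nz in \<open>auto simp: E_def\<close>)+
  then have DE: "D ** E = mat 1" and ED: "E ** D = mat 1"
    by (simp_all add: vec_eq_iff matrix_matrix_mult_def mat_def)
  \<comment> \<open>\<open>matrix_inv\<close> is a Hilbert choice, so the witness \<open>E\<close>
    is first used to show that the chosen matrix is a two-sided inverse; uniqueness of inverses then
    identifies it with \<open>E\<close>.\<close>
  have "D ** matrix_inv D = mat 1 \<and> matrix_inv D ** D = mat 1"
    unfolding matrix_inv_def
    by (rule someI[where P = "\<lambda>X. D ** X = mat 1 \<and> X ** D = mat 1" and x = E]) (rule conjI[OF DE ED])
  then have "matrix_inv D = (E ** D) ** matrix_inv D" "E ** (D ** matrix_inv D) = E"
    by (simp_all add: ED)
  then have inv: "matrix_inv D = E"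
    by (simp only: matrix_mul_assoc)
  have "(\<Sum>j\<in>UNIV. A $ i $ j * E $ j $ k) = (\<Sum>j\<in>UNIV. if j = k then A $ i $ k / D $ k $ k else 0)"
    by (intro sum.cong refl) (auto simp: E_def)
  then show "(A ** matrix_inv D) $ i $ k = A $ i $ k / D $ k $ k"
    by (simp add: inv matrix_matrix_mult_def)
qed

text \<open>Pulling the weight \<open>D $ k $ k\<close> out of column \<open>k\<close> and applying
  Cauchy--Schwarz over \<open>k\<close> leaves the Frobenius norm of the scaled matrix with row
  \<open>j\<close> multiplied by \<open>y $ j\<close>. Its square is a combination of squared row
  norms whose coefficients \<open>(y $ j)\<^sup>2\<close> sum to at most 1.\<close>

lemma sum_sqrt_le_norm_2_to_inf:
  fixes A :: "real ^ 'n ^ 'm" and y :: "real ^ 'm"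
  assumes D: "D \<in> scaling_matrices" and y: "norm y \<le> 1"
  shows "(\<Sum>k\<in>UNIV. sqrt (\<Sum>j\<in>UNIV. (A $ j $ k * y $ j)\<^sup>2)) \<le> norm_2_to_inf (A ** matrix_inv D)"
proof -
  let ?B = "A ** matrix_inv D"
  let ?q = "\<lambda>k. sqrt (\<Sum>j\<in>UNIV. (?B $ j $ k * y $ j)\<^sup>2)"
  have "sqrt (\<Sum>j\<in>UNIV. (A $ j $ k * y $ j)\<^sup>2) = D $ k $ k * ?q k" for k
  proof -
    have "(A $ j $ k * y $ j)\<^sup>2 = (D $ k $ k)\<^sup>2 * (?B $ j $ k * y $ j)\<^sup>2" for j
      using scaling_matrix_pos[OF D, of k]
      by (simp add: mult_matrix_inv_scaling_nth[OF D] power_divide power_mult_distrib)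
    then have "(\<Sum>j\<in>UNIV. (A $ j $ k * y $ j)\<^sup>2) = (D $ k $ k)\<^sup>2 * (\<Sum>j\<in>UNIV. (?B $ j $ k * y $ j)\<^sup>2)"
      by (simp add: sum_distrib_left)
    then show ?thesis
      using scaling_matrix_pos[OF D, of k] by (simp add: real_sqrt_mult)
  qed
  then have "(\<Sum>k\<in>UNIV. sqrt (\<Sum>j\<in>UNIV. (A $ j $ k * y $ j)\<^sup>2)) = (\<Sum>k\<in>UNIV. \<bar>D $ k $ k\<bar> * \<bar>?q k\<bar>)"
    using scaling_matrix_pos[OF D] by (simp add: sum_nonneg less_imp_le)
  also have "\<dots> \<le> L2_set (\<lambda>k. D $ k $ k) UNIV * L2_set ?q UNIV"
    by (rule L2_set_mult_ineq)
  also have "\<dots> = sqrt (\<Sum>k\<in>UNIV. \<Sum>j\<in>UNIV. (?B $ j $ k * y $ j)\<^sup>2)"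
    using scaling_matrix_sum_sq[OF D] by (simp add: L2_set_def sum_nonneg)
  also have "\<dots> \<le> norm_2_to_inf ?B"
  proof (rule real_le_lsqrt)
    \<comment> \<open>Interchanging the sums passes from columns to rows.\<close>
    have "(\<Sum>k\<in>UNIV. \<Sum>j\<in>UNIV. (?B $ j $ k * y $ j)\<^sup>2) = (\<Sum>j\<in>UNIV. (norm (?B $ j))\<^sup>2 * (y $ j)\<^sup>2)"
      unfolding power2_norm_eq_inner
      by (subst sum.swap) (simp add: power_mult_distrib inner_vec_def power2_eq_square[of "_ $ _"]
          sum_distrib_right)
    also have "\<dots> \<le> (\<Sum>j\<in>UNIV. (norm_2_to_inf ?B)\<^sup>2 * (y $ j)\<^sup>2)"
      by (intro sum_mono mult_right_mono power_mono norm_row_le_norm_2_to_inf) auto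
    also have "\<dots> = (norm_2_to_inf ?B)\<^sup>2 * (norm y)\<^sup>2"
      unfolding power2_norm_eq_inner[of y] inner_vec_def by (simp add: sum_distrib_left power2_eq_square)
    also have "\<dots> \<le> (norm_2_to_inf ?B)\<^sup>2"
      using y by (intro mult_left_le) (auto intro: power_le_one)
    finally show "(\<Sum>k\<in>UNIV. \<Sum>j\<in>UNIV. (?B $ j $ k * y $ j)\<^sup>2) \<le> (norm_2_to_inf ?B)\<^sup>2" .
  qed (rule norm_2_to_inf_nonneg)
  finally show ?thesis .
qed

section \<open>Means of absolute values; independence of columns and entries\<close>

text \<open>In dimension one the points 1 and -1 of the index set recover the absolute value of the
  sum from a supremum of linear terms, and the centring terms vanish because the means are
  zero.\<close>

lemma (in prob_space) expectation_abs_sum_le: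
  fixes \<xi> :: "'k::finite \<Rightarrow> 'a \<Rightarrow> real"
  assumes indep: "indep_vars (\<lambda>_. borel) \<xi> UNIV"
    and int: "\<And>k. integrable M (\<xi> k)" and mean: "\<And>k. expectation (\<xi> k) = 0"
  shows "expectation (\<lambda>\<omega>. \<bar>\<Sum>k\<in>UNIV. \<xi> k \<omega>\<bar>) \<le> 2 * expectation (\<lambda>\<omega>. sqrt (\<Sum>k\<in>UNIV. (\<xi> k \<omega>)\<^sup>2))"
proof -
  let ?T = "{-1, 0, 1} :: real set"
  let ?F = "\<lambda>\<omega>. SUP u\<in>?T. \<Sum>k\<in>UNIV. \<xi> k \<omega> \<bullet> u - expectation (\<lambda>\<omega>. \<xi> k \<omega> \<bullet> u)"
  have T: "countable ?T" "0 \<in> ?T" "?T \<subseteq> cball 0 1" by auto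
  note F = expectation_SUP_le[where \<phi> = "\<lambda>a. a", OF indep int T]
  have "\<bar>\<Sum>k\<in>UNIV. \<xi> k \<omega>\<bar> \<le> ?F \<omega>" for \<omega>
    using F(3)[of 1 \<omega>] F(3)[of "-1" \<omega>] mean by (simp add: sum_negf abs_le_iff)
  then have "expectation (\<lambda>\<omega>. \<bar>\<Sum>k\<in>UNIV. \<xi> k \<omega>\<bar>) \<le> expectation ?F"
    using F(1,2) by (intro integral_mono') auto
  also have "\<dots> \<le> 2 * expectation (\<lambda>\<omega>. sqrt (\<Sum>k\<in>UNIV. (\<xi> k \<omega>)\<^sup>2))"
    using F(4) by simp
  finally show ?thesis .
qed

lemma borel_measurable_vec_lambda:
  fixes f :: "'a \<Rightarrow> 'n::finite \<Rightarrow> real"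
  assumes "\<And>i. (\<lambda>x. f x i) \<in> borel_measurable M"
  shows "(\<lambda>x. \<chi> i. f x i) \<in> borel_measurable M"
proof -
  have "(\<lambda>x. (\<chi> i. f x i) \<bullet> axis j 1) \<in> borel_measurable M" for j
    using assms by (simp add: inner_axis)
  moreover have "\<exists>j. b = axis j 1" if "b \<in> Basis" for b :: "real ^ 'n"
    using that by (simp add: Basis_vec_def)
  ultimately show ?thesis
    by (subst borel_measurable_euclidean_space) metis
qed

text \<open>Distinct columns are functions of disjoint blocks of the independent entries.\<close>

lemma (in prob_space) indep_vars_columns:
  fixes Z :: "'a \<Rightarrow> real ^ 'n ^ 'm"
  assumes "indep_vars (\<lambda>_. borel) (\<lambda>(i, j) \<omega>. Z \<omega> $ i $ j) UNIV"
  shows "indep_vars (\<lambda>_. borel) (\<lambda>k \<omega>. column k (Z \<omega>)) UNIV"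
proof -
  let ?K = "\<lambda>k :: 'n. UNIV \<times> {k} :: ('m \<times> 'n) set"
  let ?Y = "\<lambda>k f. (\<chi> i. f (i, k)) :: real ^ 'm"
  have indep: "indep_vars (\<lambda>k. PiM (?K k) (\<lambda>_. borel))
      (\<lambda>k \<omega>. restrict (\<lambda>p. (\<lambda>(i, j) \<omega>. Z \<omega> $ i $ j) p \<omega>) (?K k)) UNIV"
    using assms by (rule indep_vars_restrict) (auto simp: disjoint_family_on_def)
  have meas: "?Y k \<in> borel_measurable (PiM (?K k) (\<lambda>_. borel))" for k
    by (intro borel_measurable_vec_lambda measurable_component_singleton) simp
  have "(\<lambda>k \<omega>. ?Y k (restrict (\<lambda>p. (\<lambda>(i, j) \<omega>. Z \<omega> $ i $ j) p \<omega>) (?K k))) = (\<lambda>k \<omega>. column k (Z \<omega>))"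
    by (intro ext) (simp add: column_def)
  from indep_vars_compose2[where Y = ?Y and N = "\<lambda>_. borel", OF indep meas, unfolded this]
  show ?thesis .
qed

text \<open>For fixed \<open>k\<close> the blocks are the singletons \<open>{(i, k)}\<close>; these
  are the summands of the inner product of column \<open>k\<close> with \<open>y\<close>.\<close>

lemma (in prob_space) indep_vars_column_entries:
  fixes Z :: "'a \<Rightarrow> real ^ 'n ^ 'm"
  assumes "indep_vars (\<lambda>_. borel) (\<lambda>(i, j) \<omega>. Z \<omega> $ i $ j) UNIV"
  shows "indep_vars (\<lambda>_. borel) (\<lambda>i \<omega>. Z \<omega> $ i $ k * y $ i) UNIV"
proof -
  have "indep_vars (\<lambda>i. PiM {(i, k)} (\<lambda>_. borel))
      (\<lambda>i \<omega>. restrict (\<lambda>p. (\<lambda>(i, j) \<omega>. Z \<omega> $ i $ j) p \<omega>) {(i, k)}) UNIV"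
    using assms by (rule indep_vars_restrict) (auto simp: disjoint_family_on_def)
  from indep_vars_compose2[where Y = "\<lambda>i f. f (i, k) * y $ i" and N = "\<lambda>_. borel", OF this]
  show ?thesis by simp
qed

section \<open>Duality and assembly of the bound\<close>

text \<open>The inequality defines a closed half-space and so passes to the closure, which contains
  \<open>sgn w\<close>, the vector at which the inner product with \<open>w\<close> equals the norm.
  For \<open>w = 0\<close> the convention \<open>sgn 0 = 0\<close> fits.\<close>

lemma norm_le_of_dense:
  fixes w :: "'a::euclidean_space"
  assumes dense: "cball 0 1 \<subseteq> closure T" and le: "\<And>y. y \<in> T \<Longrightarrow> y \<bullet> w \<le> b"
  shows "norm w \<le> b"
proof -
  have "closure T \<subseteq> {y. y \<bullet> w \<le> b}"
    using le by (intro closure_minimal closed_Collect_le continuous_intros) auto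
  moreover have "sgn w \<in> cball 0 1" by (simp add: norm_sgn)
  ultimately have "sgn w \<bullet> w \<le> b" using dense by blast
  moreover have "sgn w \<bullet> w = norm w"
    by (cases "w = 0") (simp_all add: sgn_div_norm dot_square_norm power2_eq_square)
  ultimately show ?thesis by simp
qed

theorem theorem4:
  fixes M :: "'w measure"
    and Z :: "'w \<Rightarrow> real ^ 'n ^ 'm"
  assumes "prob_space M"
    and indep: "prob_space.indep_vars M (\<lambda>_. borel)
      (\<lambda>(i, j) \<omega>. Z \<omega> $ i $ j) (UNIV :: ('m \<times> 'n) set)"
    and integrable: "\<And>i j. integrable M (\<lambda>\<omega>. Z \<omega> $ i $ j)"
    and zero_mean: "\<And>i j. (\<integral>\<omega>. Z \<omega> $ i $ j \<partial>M) = 0"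
  shows "(\<integral>\<omega>. norm_inf_to_2 (Z \<omega>) \<partial>M)
    \<le> 2 * (\<integral>\<omega>. frobenius_norm (Z \<omega>) \<partial>M)
      + 2 * (INF D \<in> scaling_matrices. \<integral>\<omega>. norm_2_to_inf (Z \<omega> ** matrix_inv D) \<partial>M)"
proof -
  interpret prob_space M by fact
  have [measurable]: "(\<lambda>\<omega>. Z \<omega> $ i $ j) \<in> borel_measurable M" for i j
    using integrable by auto
  obtain T0 :: "(real ^ 'm) set" where T0: "countable T0" "T0 \<subseteq> cball 0 1" "cball 0 1 \<subseteq> closure T0"
    by (rule separable)
  \<comment> \<open>Countability makes the supremum \<open>F\<close> measurable, density recovers
    the Euclidean norm, and the added 0 makes \<open>F\<close> nonnegative.\<close>
  define T where "T = insert 0 T0"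
  have T: "countable T" "0 \<in> T" "T \<subseteq> cball 0 1" and dense: "cball 0 1 \<subseteq> closure T"
    using T0 closure_mono[of T0 T] by (auto simp: T_def)
  let ?c = "\<lambda>k \<omega>. column k (Z \<omega>)"
  have col_meas[measurable]: "?c k \<in> borel_measurable M" for k
    unfolding column_def by (rule borel_measurable_vec_lambda) measurable
  have int_col: "integrable M (?c k)" for k
  proof (rule Bochner_Integration.integrable_bound)
    show "integrable M (\<lambda>\<omega>. \<Sum>i\<in>UNIV. \<bar>Z \<omega> $ i $ k\<bar>)" using integrable by auto
    show "AE \<omega> in M. norm (?c k \<omega>) \<le> norm (\<Sum>i\<in>UNIV. \<bar>Z \<omega> $ i $ k\<bar>)"
      using norm_le_l1_cart[of "?c k _"] by (auto simp: column_def intro: order_trans[OF _ abs_ge_self])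
  qed auto
  define \<mu> where "\<mu> k y = expectation (\<lambda>\<omega>. \<bar>?c k \<omega> \<bullet> y\<bar>)" for k and y :: "real ^ 'm"
  define F where "F \<omega> = (SUP y\<in>T. \<Sum>k\<in>UNIV. \<bar>?c k \<omega> \<bullet> y\<bar> - \<mu> k y)" for \<omega>
  note F = expectation_SUP_le[where \<phi> = abs, OF indep_vars_columns[OF indep] int_col T,
      folded \<mu>_def, folded F_def, OF abs_triangle_ineq3 abs_zero]
  have main: "expectation (\<lambda>\<omega>. norm_inf_to_2 (Z \<omega>))
      \<le> 2 * expectation (\<lambda>\<omega>. frobenius_norm (Z \<omega>)) + 2 * expectation (\<lambda>\<omega>. norm_2_to_inf (Z \<omega> ** matrix_inv D))"
    if D: "D \<in> scaling_matrices" for D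
  proof -
    let ?N = "\<lambda>\<omega>. norm_2_to_inf (Z \<omega> ** matrix_inv D)"
    have int_N: "integrable M ?N"
    proof (rule Bochner_Integration.integrable_bound)
      let ?b = "\<lambda>\<omega>. \<Sum>i\<in>UNIV. \<Sum>k\<in>UNIV. \<bar>Z \<omega> $ i $ k / D $ k $ k\<bar>"
      show "integrable M ?b" using integrable by auto
      have row: "(Z \<omega> ** matrix_inv D) $ i = (\<chi> k. Z \<omega> $ i $ k / D $ k $ k)" for \<omega> i
        by (simp add: vec_eq_iff mult_matrix_inv_scaling_nth[OF D])
      have "(\<lambda>\<omega>. (\<chi> k. Z \<omega> $ i $ k / D $ k $ k)) \<in> borel_measurable M" for i
        by (rule borel_measurable_vec_lambda) measurable
      then show "?N \<in> borel_measurable M"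
        unfolding norm_2_to_inf_eq_Max row by measurable
      have "norm ((Z \<omega> ** matrix_inv D) $ i) \<le> ?b \<omega>" for \<omega> i
      proof -
        have "norm ((Z \<omega> ** matrix_inv D) $ i) \<le> (\<Sum>k\<in>UNIV. \<bar>Z \<omega> $ i $ k / D $ k $ k\<bar>)"
          unfolding row using norm_le_l1_cart[of "\<chi> k. Z \<omega> $ i $ k / D $ k $ k"] by simp
        also have "\<dots> \<le> ?b \<omega>"
          by (rule member_le_sum) (auto intro: sum_nonneg)
        finally show ?thesis .
      qed
      then have "?N \<omega> \<le> ?b \<omega>" for \<omega>
        unfolding norm_2_to_inf_eq_Max by (intro Max.boundedI) auto
      then show "AE \<omega> in M. norm (?N \<omega>) \<le> norm (?b \<omega>)"
        by (auto simp: norm_2_to_inf_nonneg intro: order_trans[OF _ abs_ge_self])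
    qed
    have mean_le: "(\<Sum>k\<in>UNIV. \<mu> k y) \<le> 2 * expectation ?N" if y: "norm y \<le> 1" for y
    proof -
      let ?q = "\<lambda>k \<omega>. sqrt (\<Sum>i\<in>UNIV. (Z \<omega> $ i $ k * y $ i)\<^sup>2)"
      have int_q: "integrable M (?q k)" for k
      proof (rule Bochner_Integration.integrable_bound[OF int_N])
        have "?q k \<omega> \<le> ?N \<omega>" for \<omega>
        proof -
          have "?q k \<omega> \<le> (\<Sum>k\<in>UNIV. ?q k \<omega>)"
            by (rule member_le_sum) (auto simp: sum_nonneg)
          also have "\<dots> \<le> ?N \<omega>" by (rule sum_sqrt_le_norm_2_to_inf[OF D y])
          finally show ?thesis .
        qed
        then show "AE \<omega> in M. norm (?q k \<omega>) \<le> norm (?N \<omega>)"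
          by (auto simp: sum_nonneg intro: order_trans[OF _ abs_ge_self])
      qed measurable
      \<comment> \<open>The inner product of column \<open>k\<close> with \<open>y\<close> is a sum
        of independent centred scalars \<open>Z \<omega> $ i $ k * y $ i\<close>.\<close>
      have "\<mu> k y \<le> 2 * expectation (?q k)" for k
        using expectation_abs_sum_le[OF indep_vars_column_entries[OF indep, of k y]] integrable zero_mean
        by (simp add: \<mu>_def inner_vec_def column_def)
      then have "(\<Sum>k\<in>UNIV. \<mu> k y) \<le> (\<Sum>k\<in>UNIV. 2 * expectation (?q k))"
        by (rule sum_mono)
      also have "\<dots> = 2 * expectation (\<lambda>\<omega>. \<Sum>k\<in>UNIV. ?q k \<omega>)"
        using int_q by (simp add: sum_distrib_left)
      also have "\<dots> \<le> 2 * expectation ?N"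
        using int_N int_q sum_sqrt_le_norm_2_to_inf[OF D y]
        by (intro mult_left_mono integral_mono) auto
      finally show ?thesis .
    qed
    have EN: "0 \<le> expectation ?N" by (simp add: norm_2_to_inf_nonneg)
    have pointwise: "norm_inf_to_2 (Z \<omega>) \<le> F \<omega> + 2 * expectation ?N" for \<omega>
    proof (rule norm_inf_to_2_leI, rule norm_le_of_dense[OF dense])
      fix u :: "real ^ 'n" and y assume y: "y \<in> T"
      have "y \<bullet> (Z \<omega> *v u) = (\<Sum>k\<in>UNIV. u $ k * (?c k \<omega> \<bullet> y))"
        by (simp add: matrix_mult_sum inner_sum_right scalar_mult_eq_scaleR inner_commute)
      also have "\<dots> \<le> (\<Sum>k\<in>UNIV. infnorm u * \<bar>?c k \<omega> \<bullet> y\<bar>)"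
      proof (rule sum_mono)
        fix k
        have "u $ k * (?c k \<omega> \<bullet> y) \<le> \<bar>u $ k\<bar> * \<bar>?c k \<omega> \<bullet> y\<bar>"
          by (simp add: abs_mult[symmetric])
        also have "\<dots> \<le> infnorm u * \<bar>?c k \<omega> \<bullet> y\<bar>"
          by (intro mult_right_mono component_le_infnorm_cart) auto
        finally show "u $ k * (?c k \<omega> \<bullet> y) \<le> infnorm u * \<bar>?c k \<omega> \<bullet> y\<bar>" .
      qed
      \<comment> \<open>Each absolute value is split into deviation and mean: \<open>F\<close>
        bounds the sum of the deviations and \<open>mean_le\<close> that of the means, both
        uniformly in \<open>y\<close>.\<close>
      also have "\<dots> = infnorm u * ((\<Sum>k\<in>UNIV. \<bar>?c k \<omega> \<bullet> y\<bar> - \<mu> k y) + (\<Sum>k\<in>UNIV. \<mu> k y))"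
        by (simp add: sum_distrib_left sum_subtractf)
      also have "\<dots> \<le> infnorm u * (F \<omega> + 2 * expectation ?N)"
        using F(3)[OF y] mean_le[of y] T(3) y by (intro mult_left_mono add_mono infnorm_pos_le) auto
      finally show "y \<bullet> (Z \<omega> *v u) \<le> (F \<omega> + 2 * expectation ?N) * infnorm u"
        by (simp add: mult.commute)
    qed
    \<comment> \<open>A nonintegrable function has integral 0 by convention, so an integrable and
      nonnegative majorant is enough; this is where \<open>F(2)\<close> and \<open>EN\<close>
      enter.\<close>
    have "expectation (\<lambda>\<omega>. norm_inf_to_2 (Z \<omega>)) \<le> expectation (\<lambda>\<omega>. F \<omega> + 2 * expectation ?N)"
      using F(1,2) pointwise EN by (intro integral_mono') auto
    also have "\<dots> = expectation F + 2 * expectation ?N"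
      using F(1) by (simp add: prob_space)
    finally show ?thesis
      using F(4) by (simp add: frobenius_norm_eq_columns)
  qed
  \<comment> \<open>Solving \<open>main\<close> for the term in \<open>D\<close> gives a lower bound
    independent of \<open>D\<close>, hence a lower bound for the infimum.\<close>
  have "(expectation (\<lambda>\<omega>. norm_inf_to_2 (Z \<omega>)) - 2 * expectation (\<lambda>\<omega>. frobenius_norm (Z \<omega>))) / 2
      \<le> (INF D \<in> scaling_matrices. expectation (\<lambda>\<omega>. norm_2_to_inf (Z \<omega> ** matrix_inv D)))"
    using main by (intro cINF_greatest scaling_matrices_nonempty) (simp add: field_simps)
  then show ?thesis by (simp add: field_simps)
qed

end
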